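(* Let $\mathbf{s}=(s_1,\dots,s_r)$ with all $s_i\geq1$, $\boldsymbol{\gamma}=(\gamma_1,\dots,\gamma_r)\in(\overline{\mathbb{F}}_q^\times)^r$ and $\mathbf{j}\in\mathfrak{J}_{\mathbf{s}}$. Then for every $n\in\mathbb{N}$, \[ BC_n^{\mathbf{s},\boldsymbol{\gamma},\mathbf{j}}=\sum_{\log_q(n+1)\geq d_1>\cdots>d_r\geq0}\Gamma_{q^{d_1}}\left\{\begin{array}{c} n\\ q^{d_1}-1\end{array}\right\}_C \frac{(\gamma_1u_{s_1,j_1})^{q^{d_1}}\cdots(\gamma_r u_{s_r,j_r})^{q^{d_r}}}{L_{d_1}^{s_1}\cdots L_{d_r}^{s_r}}. \]
   Context: Fix a prime $p$ and a power $q$ of $p$; $A=\mathbb{F}_q[\theta]$, $k=\mathbb{F}_q(\theta)$. For $n\geq1$ put $[n]=\theta^{q^n}-\theta$, $D_n=[n]^{q^0}[n-1]^{q^1}\cdots[1]^{q^{n-1}}$, $L_n=(-1)^n[n][n-1]\cdots[1]$, and $D_0=L_0=1$. For $n\in\mathbb{N}$ with $q$-adic expansion $n=\sum_j\alpha_jq^j$ ($0\leq\alpha_j<q$) put $\Pi(n)=\prod_jD_j^{\alpha_j}$ and $\Gamma_{n+1}=\Pi(n)$. Carlitz exponential: $e_C(z)=\sum_{i\geq0}z^{q^i}/D_i$. Carlitz multiple polylogarithm: $\mathrm{Li}_{\mathbf{s}}(z_1,\dots,z_r)=\sum_{i_1>\cdots>i_r\geq0}\frac{z_1^{q^{i_1}}\cdots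 z_r^{q^{i_r}}}{L_{i_1}^{s_1}\cdots L_{i_r}^{s_r}}$. Anderson–Thakur polynomials: with $G_n(t,y)=\prod_{i=1}^n(t^{q^n}-y^{q^i})$, define $\mathfrak{H}_n(t,y)$ by $\sum_{n\geq0}\frac{\mathfrak{H}_n(t,y)}{\Gamma_{n+1}|_{\theta=t}}x^n=\left(1-\sum_{i\geq0}\frac{G_i(t,y)}{D_i|_{\theta=t}}x^{q^i}\right)^{-1}$, and $H_n(t)=\mathfrak{H}_n(t,\theta)\in A[t]$; write $H_n(t)=\sum_{j=0}^{m_{n+1}}u_{n+1,j}t^j$ with $u_{n+1,j}\in A$, $m_{n+1}=\deg_tH_n$. For $\mathbf{s}$ with $s_i\geq1$, $\mathfrak{J}_{\mathbf{s}}=\{(j_1,\dots,j_r)\in\mathbb{N}^r: 0\leq j_i\leq\deg_tH_{s_i-1}\}$. The alternating multiple poly-Bernoulli–Carlitz numbers $BC_n^{\mathbf{s},\boldsymbol{\gamma},\mathbf{j}}\in\bar{k}$ are defined by $\sum_{n\geq0}BC_n^{\mathbf{s},\boldsymbol{\gamma},\mathbf{j}}\frac{z^n}{\Pi(n)}=\frac{\mathrm{Li}_{\mathbf{s}}(e_C(z)\gamma_1u_{s_1,j_1},\gamma_2u_{s_2,j_2},\dots,\gamma_ru_{s_r,j_r})}{e_C(z)}$. Stirling–Carlitz numbers of the second kind are defined by $\frac{e_C(z)^m}{\Pi(m)}=\sum_{n\geq0}\left\{\begin{array}{c} n\\ m\end{array}\right\}_C\frac{z^n}{\Pi(n)}$.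 *)

theory Defs
  imports
    "HOL-Library.Cardinality"
    "HOL-Analysis.Infinite_Sum"
    "HOL-Algebra.Algebraic_Closure_Type"
    "HOL-Computational_Algebra.Computational_Algebra"
begin

text \<open>
  The type variable \<open>'a :: {finite, field}\<close> is the field with \<open>q = CARD('a)\<close> elements, so that
  \<open>A = 'a poly\<close> (polynomials in \<open>\<theta>\<close>), \<open>k = 'a poly fract\<close>, and the algebraic closure of \<open>k\<close> is
  \<open>'a poly fract alg_closure\<close>. Infinite sums of formal power series are taken in the
  \<open>X\<close>-adic topology, which is the library topology on \<open>fps\<close>.
\<close>

type_synonym 'a kbar = "'a poly fract alg_closure"

definition of_A :: "'a :: {finite, field} poly \<Rightarrow> 'a kbar" where
  "of_A f = to_ac (to_fract f)"

definition Fq_bar :: "'a :: {finite, field} kbar set" where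
  "Fq_bar = {x. \<exists>P :: 'a poly. P \<noteq> 0 \<and> poly (map_poly (\<lambda>c. of_A [:c:]) P) x = 0}"


section \<open>Carlitz factorials\<close>

definition carlitz_bracket :: "nat \<Rightarrow> 'a :: {finite, field} poly" where
  "carlitz_bracket n = monom 1 (CARD('a) ^ n) - monom 1 1"

definition carlitz_D :: "nat \<Rightarrow> 'a :: {finite, field} poly" where
  "carlitz_D n = (\<Prod>i<n. carlitz_bracket (n - i) ^ (CARD('a) ^ i))"

definition carlitz_L :: "nat \<Rightarrow> 'a :: {finite, field} poly" where
  "carlitz_L n = (- 1) ^ n * (\<Prod>i=1..n. carlitz_bracket i)"

text \<open>The \<open>q\<close>-adic digits of \<open>n\<close> at positions above \<open>n\<close> are zero.\<close>

definition carlitz_Pi :: "nat \<Rightarrow> 'a :: {finite, field} poly" where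
  "carlitz_Pi n = (\<Prod>j\<le>n. carlitz_D j ^ (n div CARD('a) ^ j mod CARD('a)))"

text \<open>\<open>\<Gamma>\<^sub>m\<close>, used for \<open>m \<ge> 1\<close> only.\<close>

definition carlitz_Gamma :: "nat \<Rightarrow> 'a :: {finite, field} poly" where
  "carlitz_Gamma m = carlitz_Pi (m - 1)"


section \<open>Carlitz exponential and multiple polylogarithms\<close>

definition carlitz_exp :: "'a :: {finite, field} kbar fps" where
  "carlitz_exp = (\<Sum>i. fps_const (1 / of_A (carlitz_D i)) * fps_X ^ (CARD('a) ^ i))"

text \<open>
  The arguments \<open>z\<close> are formal power series over the algebraic closure of \<open>k\<close>, and the
  summation index is the list \<open>[i\<^sub>1, \<dots>, i\<^sub>r]\<close>. The sum converges as soon as \<open>z ! 0\<close> has no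
  constant term (lemma \<open>carlitz_Li_summable\<close>); the other arguments may be constants.
\<close>

definition carlitz_Li ::
    "nat list \<Rightarrow> 'a :: {finite, field} kbar fps list \<Rightarrow> 'a kbar fps" where
  "carlitz_Li s z =
     (\<Sum>\<^sub>\<infinity>i\<in>{i. length i = length s \<and> sorted_wrt (>) i}.
        (\<Prod>l<length s. (z ! l) ^ (CARD('a) ^ (i ! l)) *
           fps_const (1 / of_A (carlitz_L (i ! l)) ^ (s ! l))))"


section \<open>Anderson--Thakur polynomials\<close>

text \<open>
  \<open>'a poly poly\<close> serves both as \<open>\<bbbF>\<^sub>q[t, y]\<close> (outer variable \<open>t\<close>, inner variable \<open>y\<close>) and as
  \<open>A[t]\<close> (outer variable \<open>t\<close>, inner variable \<open>\<theta>\<close>), so that the substitution \<open>y = \<theta>\<close> is the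
  identity. The map \<open>at_t\<close> is \<open>f \<mapsto> f|\<^bsub>\<theta>=t\<^esub>\<close>.
\<close>

definition at_t :: "'a :: {finite, field} poly \<Rightarrow> 'a poly poly" where
  "at_t f = map_poly (\<lambda>c. [:c:]) f"

definition AT_G :: "nat \<Rightarrow> 'a :: {finite, field} poly poly" where
  "AT_G n = (\<Prod>i=1..n. monom 1 (CARD('a) ^ n) - [:monom 1 (CARD('a) ^ i):])"

definition AT_gen :: "'a :: {finite, field} poly poly fract fps" where
  "AT_gen = inverse (1 - (\<Sum>i. fps_const (to_fract (AT_G i) / to_fract (at_t (carlitz_D i))) *
                              fps_X ^ (CARD('a) ^ i)))"

definition AT_H :: "nat \<Rightarrow> 'a :: {finite, field} poly poly" where
  "AT_H n = (THE h. to_fract h / to_fract (at_t (carlitz_Gamma (n + 1))) = fps_nth AT_gen n)"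

text \<open>\<open>AT_u m j\<close> is the coefficient of \<open>t\<^sup>j\<close> in \<open>H\<^bsub>m-1\<^esub>(t)\<close>, for \<open>m \<ge> 1\<close>.\<close>

definition AT_u :: "nat \<Rightarrow> nat \<Rightarrow> 'a :: {finite, field} poly" where
  "AT_u m j = coeff (AT_H (m - 1)) j"

definition AT_J :: "'a :: {finite, field} itself \<Rightarrow> nat list \<Rightarrow> nat list set" where
  "AT_J _ s = {j. length j = length s \<and>
                  (\<forall>i<length s. j ! i \<le> degree (AT_H (s ! i - 1) :: 'a poly poly))}"


section \<open>Multiple poly-Bernoulli--Carlitz numbers and Stirling--Carlitz numbers\<close>

definition BC :: "nat list \<Rightarrow> 'a :: {finite, field} kbar list \<Rightarrow> nat list \<Rightarrow> nat \<Rightarrow> 'a kbar" where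
  "BC s \<gamma> j n = of_A (carlitz_Pi n) *
     fps_nth
       (carlitz_Li s
          (map (\<lambda>i. (if i = 0 then carlitz_exp else 1) *
                    fps_const (\<gamma> ! i * of_A (AT_u (s ! i) (j ! i)))) [0..<length s])
        / carlitz_exp) n"

definition stirling_carlitz :: "nat \<Rightarrow> nat \<Rightarrow> 'a :: {finite, field} kbar" where
  "stirling_carlitz n m = of_A (carlitz_Pi n) *
     fps_nth (carlitz_exp ^ m * fps_const (1 / of_A (carlitz_Pi m))) n"


section \<open>Well-definedness\<close>

lemma card_Fq: "CARD('a :: {finite, field}) \<ge> 2"
proof -
  have "card {0 :: 'a, 1} \<le> CARD('a)"
    by (rule card_mono) auto
  then show ?thesis by simp
qed

lemma of_A_eq_0_iff [simp]: "of_A f = 0 \<longleftrightarrow> f = 0"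
  by (simp add: of_A_def)

lemma carlitz_bracket_nonzero:
  assumes "n > 0"
  shows "carlitz_bracket n \<noteq> (0 :: 'a :: {finite, field} poly)"
proof
  assume "carlitz_bracket n = (0 :: 'a poly)"
  then have "coeff (carlitz_bracket n :: 'a poly) 1 = 0" by simp
  moreover have "CARD('a) ^ n \<noteq> 1"
    using card_Fq[where 'a='a] assms by simp
  ultimately show False
    by (simp add: carlitz_bracket_def)
qed

lemma carlitz_D_nonzero: "carlitz_D n \<noteq> 0"
  by (auto simp: carlitz_D_def carlitz_bracket_nonzero)

lemma carlitz_Pi_nonzero: "carlitz_Pi n \<noteq> 0"
  by (auto simp: carlitz_Pi_def carlitz_D_nonzero)

lemma BC_generating_function:
  "Abs_fps (\<lambda>n. BC s \<gamma> j n / of_A (carlitz_Pi n)) =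
     carlitz_Li s
       (map (\<lambda>i. (if i = 0 then carlitz_exp else 1) *
                 fps_const (\<gamma> ! i * of_A (AT_u (s ! i) (j ! i)))) [0..<length s])
     / carlitz_exp"
  by (rule fps_ext) (simp add: BC_def carlitz_Pi_nonzero)

lemma stirling_carlitz_generating_function:
  "Abs_fps (\<lambda>n. stirling_carlitz n m / of_A (carlitz_Pi n)) =
     carlitz_exp ^ m * fps_const (1 / of_A (carlitz_Pi m))"
  by (rule fps_ext) (simp add: stirling_carlitz_def carlitz_Pi_nonzero)

lemma less_power_ge2: "q \<ge> 2 \<Longrightarrow> (n :: nat) < q ^ n"
  by (rule less_le_trans[OF less_exp power_mono]) auto

lemma q_power_series_sums:
  fixes c :: "nat \<Rightarrow> 'b :: field"
  assumes "q \<ge> 2"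
  shows "(\<lambda>i. fps_const (c i) * fps_X ^ (q ^ i)) sums
           Abs_fps (\<lambda>m. \<Sum>i\<le>m. if m = q ^ i then c i else 0)"
  unfolding sums_def
proof (rule tendsto_fpsI)
  fix m
  have "(\<Sum>i<N. fps_nth (fps_const (c i) * fps_X ^ (q ^ i)) m) =
          (\<Sum>i\<le>m. if m = q ^ i then c i else 0)" if "N > m" for N
  proof (rule sum.mono_neutral_cong_right)
    show "\<forall>i\<in>{..<N} - {..m}. fps_nth (fps_const (c i) * fps_X ^ (q ^ i)) m = 0"
    proof
      fix i assume "i \<in> {..<N} - {..m}"
      then have "m < q ^ i"
        using less_power_ge2[OF assms, of i] by auto
      then show "fps_nth (fps_const (c i) * fps_X ^ (q ^ i)) m = 0"
        by simp
    qed
  qed (use that in \<open>auto simp: fps_X_power_iff\<close>)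
  then show "eventually (\<lambda>N. fps_nth (\<Sum>i<N. fps_const (c i) * fps_X ^ (q ^ i)) m =
      fps_nth (Abs_fps (\<lambda>m. \<Sum>i\<le>m. if m = q ^ i then c i else 0)) m) sequentially"
    by (intro eventually_sequentiallyI[of "Suc m"]) (simp add: fps_sum_nth)
qed

lemma carlitz_exp_sums:
  "(\<lambda>i. fps_const (1 / of_A (carlitz_D i)) * fps_X ^ (CARD('a :: {finite, field}) ^ i)) sums
     (carlitz_exp :: 'a kbar fps)"
  unfolding carlitz_exp_def
  by (rule summable_sums, rule sums_summable, rule q_power_series_sums, rule card_Fq)

lemma carlitz_Li_summable:
  fixes z :: "'a :: {finite, field} kbar fps list"
  assumes "s \<noteq> []" and z0: "fps_nth (z ! 0) 0 = 0"
  shows "(\<lambda>i. \<Prod>l<length s. (z ! l) ^ (CARD('a) ^ (i ! l)) *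
            fps_const (1 / of_A (carlitz_L (i ! l)) ^ (s ! l)))
         summable_on {i. length i = length s \<and> sorted_wrt (>) i}"
proof -
  define f where "f = (\<lambda>i. \<Prod>l<length s. (z ! l) ^ (CARD('a) ^ (i ! l)) *
            fps_const (1 / of_A (carlitz_L (i ! l)) ^ (s ! l)))"
  define I where "I = {i :: nat list. length i = length s \<and> sorted_wrt (>) i}"
  define I' where "I' = (\<lambda>m. {i \<in> I. i ! 0 \<le> m})"
  obtain r where r: "length s = Suc r" using assms(1) by (cases s) auto
  have fin: "finite (I' m)" for m
  proof (rule finite_subset)
    show "I' m \<subseteq> {i. set i \<subseteq> {..m} \<and> length i = length s}"
    proof
      fix i assume "i \<in> I' m"
      then have i: "length i = length s" "sorted_wrt (>) i" "i ! 0 \<le> m"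
        by (auto simp: I'_def I_def)
      then have "set i \<subseteq> {..m}" by (cases i) auto
      with i show "i \<in> {i. set i \<subseteq> {..m} \<and> length i = length s}" by simp
    qed
  qed (rule finite_lists_length_eq, simp)
  have zero: "fps_nth (f i) m = 0" if "i ! 0 > m" for i m
  proof -
    have "fps_nth ((z ! 0) ^ (CARD('a) ^ (i ! 0))) k = 0" if "k \<le> m" for k
      using startsby_zero_power_prefix[OF z0, of "CARD('a) ^ (i ! 0)"] that \<open>i ! 0 > m\<close>
        less_power_ge2[OF card_Fq[where 'a='a], of "i ! 0"] by simp
    then show ?thesis
      unfolding f_def r prod.lessThan_Suc_shift mult.assoc
      by (simp add: fps_mult_nth)
  qed
  have "(f has_sum Abs_fps (\<lambda>m. \<Sum>i\<in>I' m. fps_nth (f i) m)) I"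
    unfolding has_sum_def
  proof (rule tendsto_fpsI)
    fix m
    have "fps_nth (sum f F) m = (\<Sum>i\<in>I' m. fps_nth (f i) m)"
      if "finite F" "I' m \<subseteq> F" "F \<subseteq> I" for F
      unfolding fps_sum_nth
      by (rule sum.mono_neutral_right) (use that zero[of m] in \<open>auto simp: I'_def intro: leI\<close>)
    then show "eventually (\<lambda>F. fps_nth (sum f F) m =
        fps_nth (Abs_fps (\<lambda>m. \<Sum>i\<in>I' m. fps_nth (f i) m)) m) (finite_subsets_at_top I)"
      using fin unfolding eventually_finite_subsets_at_top fps_nth_Abs_fps
      by (intro exI[of _ "I' m"]) (auto simp: I'_def)
  qed
  then show ?thesis
    unfolding f_def I_def by (rule has_sum_imp_summable)
qed

lemma carlitz_D_power_dvd:
  "(carlitz_D i :: 'a :: {finite, field} poly) ^ CARD('a) dvd carlitz_D (Suc i)"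
proof -
  have "carlitz_D (Suc i) = carlitz_bracket (Suc i) * (carlitz_D i :: 'a poly) ^ CARD('a)"
    unfolding carlitz_D_def prod.lessThan_Suc_shift
    by (simp add: prod_power_distrib mult.commute flip: power_mult)
  then show ?thesis by simp
qed

definition digit_prod :: "nat \<Rightarrow> nat \<Rightarrow> nat \<Rightarrow> 'a :: {finite, field} poly" where
  "digit_prod a N n = (\<Prod>j<N. carlitz_D (a + j) ^ (n div CARD('a) ^ j mod CARD('a)))"

lemma digit_prod_Suc:
  "digit_prod a (Suc N) n =
     (carlitz_D a :: 'a :: {finite, field} poly) ^ (n mod CARD('a)) *
       digit_prod (Suc a) N (n div CARD('a))"
  by (simp add: digit_prod_def prod.lessThan_Suc_shift div_mult2_eq del: prod.lessThan_Suc)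

lemma digit_prod_dvd:
  assumes "0 < n" "n < CARD('a :: {finite, field}) ^ N"
  shows "carlitz_D a * digit_prod a N (n - 1) dvd (digit_prod a N n :: 'a poly)"
  using assms
proof (induction N arbitrary: a n)
  case (Suc N)
  define q where "q = CARD('a)"
  have q: "q \<ge> 2" unfolding q_def by (rule card_Fq)
  show ?case
  proof (cases "n mod q = 0")
    case False
    then have "(n - 1) div q = n div q" "n mod q = Suc ((n - 1) mod q)"
      using Suc.prems(1) by (cases n; auto simp: div_Suc mod_Suc split: if_splits)+
    then show ?thesis
      by (simp add: digit_prod_Suc flip: q_def)
  next
    case True
    then obtain m where m: "n = m * q" by (metis mod_0_imp_dvd dvd_def mult.commute)
    then have "m > 0" using Suc.prems(1) by (cases m) auto
    then obtain l where l: "m = Suc l" by (cases m) auto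
    have n1: "n - 1 = l * q + (q - 1)" using m l q by simp
    have "(n - 1) div q = l" "(n - 1) mod q = q - 1"
      unfolding n1 by (subst div_mult_self3 mod_mult_self3; use q in simp)+
    moreover have "n div q = Suc l" "n mod q = 0" using m l q by auto
    moreover have "carlitz_D a ^ q * digit_prod (Suc a) N l dvd (digit_prod (Suc a) N (Suc l) :: 'a poly)"
      proof -
      have "Suc l * q < q ^ N * q"
        using Suc.prems(2) unfolding m l q_def by (simp only: power_Suc2)
      then have "carlitz_D (Suc a) * digit_prod (Suc a) N l dvd (digit_prod (Suc a) N (Suc l) :: 'a poly)"
        using Suc.IH[of "Suc l" "Suc a"] by (simp only: mult_less_cancel2 q_def) simp
      with mult_dvd_mono[OF carlitz_D_power_dvd dvd_refl] show ?thesis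
        unfolding q_def by (rule dvd_trans)
    qed
    moreover have "carlitz_D a * (carlitz_D a :: 'a poly) ^ (q - 1) = carlitz_D a ^ q"
      using q by (cases q) auto
    ultimately show ?thesis
      by (simp only: digit_prod_Suc flip: q_def mult.assoc) simp
  qed
qed simp

lemma digit_prod_dvd':
  assumes "CARD('a :: {finite, field}) ^ i \<le> n" "n < CARD('a) ^ N"
  shows "carlitz_D (a + i) * digit_prod a N (n - CARD('a) ^ i) dvd (digit_prod a N n :: 'a poly)"
  using assms
proof (induction i arbitrary: a n N)
  case 0
  then show ?case using digit_prod_dvd[of n N a, where 'a='a] by simp
next
  case (Suc i)
  define q where "q = CARD('a)"
  have q: "q \<ge> 2" unfolding q_def by (rule card_Fq)
  obtain M where M: "N = Suc M"
    using Suc.prems q by (cases N) (auto simp: q_def)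
  have le: "q ^ i \<le> n div q"
    using Suc.prems(1) q by (simp add: q_def less_eq_div_iff_mult_less_eq mult.commute)
  have lt: "n div q < q ^ M"
    using Suc.prems(2) q by (simp add: q_def M less_mult_imp_div_less mult.commute)
  have "n - q ^ Suc i = (n div q - q ^ i) * q + n mod q"
  proof -
    have "q ^ i * q \<le> n div q * q" using le by (rule mult_le_mono1)
    then show ?thesis
      using div_mult_mod_eq[of n q] by (simp only: diff_mult_distrib power_Suc2)
  qed
  then have "(n - q ^ Suc i) div q = n div q - q ^ i" "(n - q ^ Suc i) mod q = n mod q"
    using q by auto
  then show ?case
    using Suc.IH[of "n div q" M "Suc a"] le lt
    by (simp add: M digit_prod_Suc mult.left_commute mult_dvd_mono flip: q_def del: power_Suc)
qed

lemma carlitz_Pi_dvd: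
  assumes "CARD('a :: {finite, field}) ^ i \<le> n"
  shows "carlitz_D i * carlitz_Pi (n - CARD('a) ^ i) dvd (carlitz_Pi n :: 'a poly)"
proof -
  define q where "q = CARD('a)"
  have q: "q \<ge> 2" unfolding q_def by (rule card_Fq)
  have less: "j < q ^ j" for j
    using q by (rule less_power_ge2)
  have Pi: "carlitz_Pi m = (digit_prod 0 N m :: 'a poly)" if "N > m" for N m
    unfolding carlitz_Pi_def digit_prod_def add_0
  proof (rule prod.mono_neutral_cong_left)
    show "\<forall>j\<in>{..<N} - {..m}. carlitz_D j ^ (m div CARD('a) ^ j mod CARD('a)) = (1 :: 'a poly)"
    proof
      fix j assume "j \<in> {..<N} - {..m}"
      then have "m < q ^ j" using less[of j] by auto
      then show "carlitz_D j ^ (m div CARD('a) ^ j mod CARD('a)) = (1 :: 'a poly)"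
        by (simp add: q_def)
    qed
  qed (use that in auto)
  have "n < q ^ Suc n" using less[of "Suc n"] by simp
  then show ?thesis
    using digit_prod_dvd'[of i n "Suc n" 0, where 'a='a] assms
    by (simp add: Pi[of _ "Suc n"] q_def)
qed

lemma at_t_mult: "at_t (f * g) = at_t f * at_t (g :: 'a :: {finite, field} poly)"
proof -
  have const_sum: "[:sum h B:] = (\<Sum>x\<in>B. [:h x:])" for h :: "nat \<Rightarrow> 'a" and B
    by (rule poly_eqI) (simp add: coeff_sum coeff_pCons split: nat.split)
  show ?thesis
    by (rule poly_eqI) (simp add: at_t_def coeff_map_poly coeff_mult const_sum mult.commute)
qed

lemma at_t_eq_0_iff [simp]: "at_t f = 0 \<longleftrightarrow> f = 0"
  by (simp add: at_t_def map_poly_eq_0_iff)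

lemma AT_gen_integral:
  "\<exists>h. fps_nth AT_gen n * to_fract (at_t (carlitz_Pi n)) = to_fract (h :: 'a :: {finite, field} poly poly)"
proof (induction n rule: less_induct)
  case (less n)
  define q where "q = CARD('a)"
  have q: "q \<ge> 2" unfolding q_def by (rule card_Fq)
  define c where "c = (\<lambda>i. to_fract (AT_G i) / to_fract (at_t (carlitz_D i)) :: 'a poly poly fract)"
  define S where "S = Abs_fps (\<lambda>m. \<Sum>i\<le>m. if m = q ^ i then c i else 0)"
  have gen: "AT_gen = inverse (1 - S)"
    unfolding AT_gen_def S_def c_def q_def
    by (rule arg_cong[where f = "\<lambda>x. inverse (1 - x)"], rule sums_unique[symmetric],
        rule q_power_series_sums, rule card_Fq)
  have S0: "fps_nth S 0 = 0" using q by (simp add: S_def)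
  have "AT_gen * (1 - S) = 1"
    unfolding gen by (rule inverse_mult_eq_1) (simp add: S0)
  then have eq: "AT_gen = 1 + S * AT_gen" by (simp add: algebra_simps)
  show ?case
  proof (cases "n = 0")
    case True
    have "fps_nth AT_gen 0 = (1 :: 'a poly poly fract)" by (subst eq) (simp add: S0)
    then show ?thesis using True by auto
  next
    case False
    have "\<exists>h. (if k = q ^ i then c i else 0) * fps_nth AT_gen (n - k) * to_fract (at_t (carlitz_Pi n)) =
            to_fract h" if "k \<le> n" for k i
    proof (cases "k = q ^ i")
      case True
      with that have "q ^ i \<le> n" by simp
      then obtain w where w: "carlitz_Pi n = carlitz_D i * carlitz_Pi (n - q ^ i) * (w :: 'a poly)"
        using carlitz_Pi_dvd[of i n, where 'a='a] unfolding q_def by (auto elim: dvdE)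
      have "n - q ^ i < n" using False q by simp
      from less[OF this] obtain h where
        h: "fps_nth AT_gen (n - q ^ i) * to_fract (at_t (carlitz_Pi (n - q ^ i))) = to_fract (h :: 'a poly poly)"
        by blast
      have "c i * fps_nth AT_gen (n - q ^ i) * to_fract (at_t (carlitz_Pi n)) =
          c i * to_fract (at_t (carlitz_D i)) *
          (fps_nth AT_gen (n - q ^ i) * to_fract (at_t (carlitz_Pi (n - q ^ i)))) * to_fract (at_t w)"
        unfolding w by (simp add: at_t_mult mult_ac)
      also have "\<dots> = to_fract (AT_G i * h * at_t w)"
        unfolding h by (simp add: c_def carlitz_D_nonzero)
      finally show ?thesis using True by (simp only: if_True simp_thms) blast
    qed (auto intro: exI[of _ 0])
    then obtain H where H: "\<And>k i. k \<le> n \<Longrightarrow>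
        (if k = q ^ i then c i else 0) * fps_nth AT_gen (n - k) * to_fract (at_t (carlitz_Pi n)) =
          to_fract (H k i)"
      by metis
    have to_fract_sum: "to_fract (sum g B) = (\<Sum>x\<in>B. to_fract (g x))"
      for g :: "nat \<Rightarrow> 'a poly poly" and B
      by (induction B rule: infinite_finite_induct) auto
    have "fps_nth AT_gen n * to_fract (at_t (carlitz_Pi n)) =
      (\<Sum>k\<le>n. \<Sum>i\<le>k. (if k = q ^ i then c i else 0) * fps_nth AT_gen (n - k) * to_fract (at_t (carlitz_Pi n)))"
      by (subst eq) (use False in \<open>simp add: fps_mult_nth S_def sum_distrib_right atLeast0AtMost\<close>)
    also have "\<dots> = to_fract (\<Sum>k\<le>n. \<Sum>i\<le>k. H k i)"
      by (simp add: H to_fract_sum)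
    finally show ?thesis by blast
  qed
qed

lemma AT_H_generating_function:
  "Abs_fps (\<lambda>n. to_fract (AT_H n) / to_fract (at_t (carlitz_Gamma (n + 1)))) =
     (AT_gen :: 'a :: {finite, field} poly poly fract fps)"
proof (rule fps_ext, simp only: fps_nth_Abs_fps)
  fix n
  have nz: "to_fract (at_t (carlitz_Gamma (n + 1))) \<noteq> (0 :: 'a poly poly fract)"
    by (simp add: carlitz_Gamma_def carlitz_Pi_nonzero)
  obtain h :: "'a poly poly" where
    "fps_nth AT_gen n * to_fract (at_t (carlitz_Gamma (n + 1))) = to_fract h"
    using AT_gen_integral[of n, where 'a='a] by (auto simp: carlitz_Gamma_def)
  with nz have "to_fract h / to_fract (at_t (carlitz_Gamma (n + 1))) = fps_nth AT_gen n"
    by (simp add: field_simps)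
  moreover from this nz have "h' = h"
    if "to_fract h' / to_fract (at_t (carlitz_Gamma (n + 1))) = fps_nth AT_gen n"
    for h' :: "'a poly poly"
    using that by (metis divide_cancel_right to_fract_eq_iff)
  ultimately show "to_fract (AT_H n) / to_fract (at_t (carlitz_Gamma (n + 1))) =
      (fps_nth AT_gen n :: 'a poly poly fract)"
    unfolding AT_H_def by (rule theI)
qed

end

theory Submission
  imports Defs
begin

text \<open>
  Substituting \<open>e\<^sub>C(z)\<close> into the first argument turns the polylogarithm into
  \<open>\<Sum>\<^sub>d e\<^sub>C(z) ^ (q ^ d\<^sub>1) * C\<^sub>d\<close> with constants \<open>C\<^sub>d\<close>. Dividing by \<open>e\<^sub>C(z)\<close> leaves
  \<open>e\<^sub>C(z) ^ (q ^ d\<^sub>1 - 1) * C\<^sub>d\<close>, whose coefficients are Stirling--Carlitz numbers. This power series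
  has order at least \<open>q ^ d\<^sub>1 - 1\<close>, so only \<open>q ^ d\<^sub>1 \<le> n + 1\<close> contributes to the coefficient of
  \<open>z ^ n\<close>.
\<close>

text \<open>If each coefficient sees only finitely many summands, then every coefficient of the
  finite partial sums is eventually constant, and this is convergence in the X-adic
  topology.\<close>

lemma fps_has_sumI:
  fixes f :: "'i \<Rightarrow> 'b :: comm_ring_1 fps"
  assumes fin: "\<And>m. finite (K m)" and sub: "\<And>m. K m \<subseteq> I"
    and zero: "\<And>i m. i \<in> I - K m \<Longrightarrow> fps_nth (f i) m = 0"
    and nth: "\<And>m. fps_nth S m = (\<Sum>i\<in>K m. fps_nth (f i) m)"
  shows "(f has_sum S) I"
  unfolding has_sum_def
proof (rule tendsto_fpsI)
  fix m
  have "fps_nth (sum f F) m = fps_nth S m" if "finite F" "K m \<subseteq> F" "F \<subseteq> I" for F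
    unfolding fps_sum_nth nth
    by (rule sum.mono_neutral_right) (use that zero in auto)
  then show "eventually (\<lambda>F. fps_nth (sum f F) m = fps_nth S m) (finite_subsets_at_top I)"
    using fin sub unfolding eventually_finite_subsets_at_top
    by (intro exI[of _ "K m"]) auto
qed

text \<open>The head bounds all entries. For \<open>r = 0\<close> the value of \<open>i ! 0\<close>
  is unspecified, but then \<open>[]\<close> is the only candidate.\<close>

lemma finite_decreasing_lists: "finite {i :: nat list. length i = r \<and> sorted_wrt (>) i \<and> i ! 0 \<le> m}"
proof (rule finite_subset)
  show "{i. length i = r \<and> sorted_wrt (>) i \<and> i ! 0 \<le> m} \<subseteq>
        {i. set i \<subseteq> {..m} \<and> length i = r}"
  proof
    fix i assume "i \<in> {i :: nat list. length i = r \<and> sorted_wrt (>) i \<and> i ! 0 \<le> m}"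
    then show "i \<in> {i. set i \<subseteq> {..m} \<and> length i = r}"
      by (cases i) auto
  qed
qed (rule finite_lists_length_eq, simp)

lemma carlitz_exp_eq:
  "(carlitz_exp :: 'a :: {finite, field} kbar fps) =
     Abs_fps (\<lambda>m. \<Sum>i\<le>m. if m = CARD('a) ^ i then 1 / of_A (carlitz_D i) else 0)"
  by (rule sums_unique2[OF carlitz_exp_sums q_power_series_sums[OF card_Fq]])

lemma carlitz_exp_nth_0: "fps_nth (carlitz_exp :: 'a :: {finite, field} kbar fps) 0 = 0"
  by (simp add: carlitz_exp_eq)

text \<open>The linear coefficient is 1/D_0 = 1. Nonvanishing lets a factor
  \<open>carlitz_exp\<close> be cancelled exactly.\<close>

lemma carlitz_exp_nonzero: "carlitz_exp \<noteq> (0 :: 'a :: {finite, field} kbar fps)"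
proof
  assume "carlitz_exp = (0 :: 'a kbar fps)"
  then have "fps_nth (carlitz_exp :: 'a kbar fps) 1 = 0" by simp
  moreover have "CARD('a) \<noteq> 1" using card_Fq[where 'a='a] by simp
  ultimately show False by (simp add: carlitz_exp_eq carlitz_D_nonzero)
qed

lemma carlitz_exp_power_nth_eq_0:
  "m < k \<Longrightarrow> fps_nth ((carlitz_exp :: 'a :: {finite, field} kbar fps) ^ k) m = 0"
  by (rule startsby_zero_power_prefix[OF carlitz_exp_nth_0, rule_format])

text \<open>The core of the theorem, for arbitrary constants \<open>c i\<close> and before the
  factor \<Pi>(n) is multiplied in.\<close>

lemma carlitz_Li_exp_div_exp_nth:
  fixes c :: "nat \<Rightarrow> 'a :: {finite, field} kbar"
  assumes "s \<noteq> []"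
  shows "fps_nth (carlitz_Li s
           (map (\<lambda>i. (if i = 0 then carlitz_exp else 1) * fps_const (c i)) [0..<length s]) / carlitz_exp) n =
    (\<Sum>d\<in>{d. length d = length s \<and> sorted_wrt (>) d \<and> CARD('a) ^ (d ! 0) \<le> n + 1}.
       fps_nth (carlitz_exp ^ (CARD('a) ^ (d ! 0) - 1)) n *
       ((\<Prod>i<length s. c i ^ (CARD('a) ^ (d ! i))) /
        (\<Prod>i<length s. of_A (carlitz_L (d ! i)) ^ (s ! i))))"
proof -
  define q where "q = CARD('a)"
  have q: "q \<ge> 2" unfolding q_def by (rule card_Fq)
  define e where "e = (carlitz_exp :: 'a kbar fps)"
  define I where "I = {d :: nat list. length d = length s \<and> sorted_wrt (>) d}"
  define K where "K = (\<lambda>m. {d :: nat list. length d = length s \<and> sorted_wrt (>) d \<and> d ! 0 \<le> m})"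
  define C where "C = (\<lambda>d :: nat list. (\<Prod>i<length s. c i ^ (q ^ (d ! i))) /
        (\<Prod>i<length s. of_A (carlitz_L (d ! i) :: 'a poly) ^ (s ! i)))"
  define g where "g = (\<lambda>d. e ^ (q ^ (d ! 0) - 1) * fps_const (C d))"
  \<comment> \<open>\<open>G\<close> is the candidate quotient. Cutting off at
    \<open>d ! 0 \<le> m\<close> loses nothing: \<open>g d\<close> has order at least q^(d_1) - 1,
    which is at least d_1.\<close>
  define G where "G = Abs_fps (\<lambda>m. \<Sum>d\<in>K m. fps_nth (g d) m)"
  have fin: "finite (K m)" for m
    unfolding K_def by (rule finite_decreasing_lists)
  have g_0: "fps_nth (g d) m = 0" if "m + 1 < q ^ (d ! 0)" for d m
    using that carlitz_exp_power_nth_eq_0[of m "q ^ (d ! 0) - 1", where 'a='a]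
    by (simp add: g_def e_def)
  have g_K: "fps_nth (g d) m = 0" if "d \<in> I - K m" for d m
    using that less_power_ge2[OF q, of "d ! 0"] by (intro g_0) (auto simp: I_def K_def)
  have G_nth: "fps_nth G k = (\<Sum>d\<in>K m. fps_nth (g d) k)" if "k \<le> m" for k m
    unfolding G_def fps_nth_Abs_fps
    by (rule sum.mono_neutral_left) (use that fin g_K in \<open>auto simp: K_def I_def\<close>)
  \<comment> \<open>The cutoff \<open>K m\<close> serves all coefficients up to \<open>m\<close> at
    once, so the Cauchy product is a finite double sum and can be swapped.\<close>
  have eG_nth: "fps_nth (e * G) m = (\<Sum>d\<in>K m. fps_nth (e * g d) m)" for m
  proof -
    have "fps_nth (e * G) m = (\<Sum>k=0..m. \<Sum>d\<in>K m. fps_nth e k * fps_nth (g d) (m - k))"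
      unfolding fps_mult_nth by (rule sum.cong) (simp_all add: G_nth[of _ m] sum_distrib_left)
    also have "\<dots> = (\<Sum>d\<in>K m. fps_nth (e * g d) m)"
      unfolding fps_mult_nth by (rule sum.swap)
    finally show ?thesis .
  qed
  have eg_K: "fps_nth (e * g d) m = 0" if "d \<in> I - K m" for d m
    unfolding fps_mult_nth
  proof (rule sum.neutral, rule ballI)
    fix k
    from that have "d \<in> I - K (m - k)" by (auto simp: I_def K_def)
    then show "fps_nth e k * fps_nth (g d) (m - k) = 0" by (simp add: g_K)
  qed
  have sum_eg: "((\<lambda>d. e * g d) has_sum e * G) I"
    by (rule fps_has_sumI[where K = K]) (use fin eg_K eG_nth in \<open>auto simp: K_def I_def\<close>)
  define z where "z = map (\<lambda>i. (if i = 0 then e else 1) * fps_const (c i)) [0..<length s]"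
  have summand: "(\<Prod>l<length s. (z ! l) ^ (q ^ (d ! l)) *
        fps_const (1 / of_A (carlitz_L (d ! l) :: 'a poly) ^ (s ! l))) = e * g d" for d
  proof -
    have const_prod: "(\<Prod>l\<in>B. fps_const (h l)) = fps_const (\<Prod>l\<in>B. h l)"
      for h :: "nat \<Rightarrow> 'a kbar" and B
      by (induction B rule: infinite_finite_induct) simp_all
    have "(\<Prod>l<length s. (z ! l) ^ (q ^ (d ! l)) *
        fps_const (1 / of_A (carlitz_L (d ! l) :: 'a poly) ^ (s ! l))) =
      (\<Prod>l<length s. (if l = 0 then e ^ (q ^ (d ! 0)) else 1) *
         fps_const (c l ^ (q ^ (d ! l)) / of_A (carlitz_L (d ! l) :: 'a poly) ^ (s ! l)))"
      by (rule prod.cong) (auto simp: z_def power_mult_distrib fps_const_power mult.assoc)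
    also have "\<dots> = e ^ (q ^ (d ! 0)) * fps_const (C d)"
      using assms by (simp add: prod.distrib const_prod C_def prod_dividef)
    \<comment> \<open>The exponent q^(d_1) is positive, so one factor \<open>e\<close> splits off;
      division by \<open>e\<close> will cancel it.\<close>
    also have "\<dots> = e * g d"
      using q by (simp add: g_def power_eq_if[of e "q ^ (d ! 0)"] mult.assoc)
    finally show ?thesis .
  qed
  have "carlitz_Li s z = e * G"
    unfolding carlitz_Li_def summand[unfolded q_def] using infsumI[OF sum_eg] by (simp add: I_def)
  moreover have "e \<noteq> 0" unfolding e_def by (rule carlitz_exp_nonzero)
  ultimately have "fps_nth (carlitz_Li s z / e) n = (\<Sum>d\<in>K n. fps_nth (g d) n)"
    by (simp add: G_def)
  \<comment> \<open>\<open>K n\<close> is a crude cutoff. The sharp one comes from the order q^(d_1)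
    - 1 of \<open>g d\<close>, hence the bound \<open>n + 1\<close>.\<close>
  also have "\<dots> = (\<Sum>d\<in>{d. length d = length s \<and> sorted_wrt (>) d \<and> q ^ (d ! 0) \<le> n + 1}. fps_nth (g d) n)"
  proof (rule sum.mono_neutral_right)
    show "{d. length d = length s \<and> sorted_wrt (>) d \<and> q ^ (d ! 0) \<le> n + 1} \<subseteq> K n"
      using less_le_trans[OF less_power_ge2[OF q]] by (fastforce simp: K_def)
  qed (use fin g_0 in \<open>auto simp: K_def not_le\<close>)
  finally show ?thesis
    unfolding z_def g_def C_def fps_mult_right_const_nth unfolding e_def q_def .
qed

theorem theorem3p7:
  fixes s j :: "nat list"
    and \<gamma> :: "'a :: {finite, field} kbar list"
    and n :: nat
  assumes "s \<noteq> []"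
    and "\<forall>i<length s. s ! i \<ge> 1"
    and "length \<gamma> = length s"
    and "\<forall>i<length s. \<gamma> ! i \<in> Fq_bar - {0}"
    and "j \<in> AT_J TYPE('a) s"
  shows "BC s \<gamma> j n =
    (\<Sum>d\<in>{d. length d = length s \<and> sorted_wrt (>) d \<and>
             log (real CARD('a)) (real (n + 1)) \<ge> real (d ! 0)}.
       of_A (carlitz_Gamma (CARD('a) ^ (d ! 0))) * stirling_carlitz n (CARD('a) ^ (d ! 0) - 1) *
       ((\<Prod>i<length s. (\<gamma> ! i * of_A (AT_u (s ! i) (j ! i))) ^ (CARD('a) ^ (d ! i))) /
        (\<Prod>i<length s. of_A (carlitz_L (d ! i)) ^ (s ! i))))"
proof -
  define q where "q = CARD('a)"
  have q: "q \<ge> 2" unfolding q_def by (rule card_Fq)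
  have log_iff: "log (real q) (real (n + 1)) \<ge> real k \<longleftrightarrow> q ^ k \<le> n + 1" for k
  proof -
    have "log (real q) (real (n + 1)) \<ge> real k \<longleftrightarrow> real q powr real k \<le> real (n + 1)"
      using q by (intro le_log_iff) auto
    also have "\<dots> \<longleftrightarrow> real (q ^ k) \<le> real (n + 1)"
      using q by (simp add: powr_realpow)
    finally show ?thesis by (simp only: of_nat_le_iff)
  qed
  \<comment> \<open>\<Gamma> at q^k is \<Pi>(q^k - 1), exactly the denominator in the
    Stirling--Carlitz number.\<close>
  have stirling: "of_A (carlitz_Gamma (q ^ k)) * stirling_carlitz n (q ^ k - 1) =
      of_A (carlitz_Pi n :: 'a poly) * fps_nth (carlitz_exp ^ (q ^ k - 1)) n" for k
    by (simp add: carlitz_Gamma_def stirling_carlitz_def carlitz_Pi_nonzero)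
  show ?thesis
    unfolding BC_def carlitz_Li_exp_div_exp_nth[OF assms(1)] sum_distrib_left
      log_iff[unfolded q_def] stirling[unfolded q_def] mult.assoc ..
qed

end
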